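(* Let $\{x^t\}_{t\ge 0}$ be the iterates of the multiplicative gradient (MG) method started from some $x^0\in\Delta_n$ with $x^0>0$ (entrywise), and let $\bar x^t:=\frac{1}{t+1}\sum_{k=0}^t x^k$. Define $\mathrm{dist}_{\rm KL}(x^0,\mathcal{X}^* ):=\min_{x\in\mathcal{X}^*}D_{\rm KL}(x,x^0)$, and suppose $R_{y^*}>0$. Then for all $t\ge 0$, $$\max\{\mathrm{dist}_{\|\cdot\|}(x^t,\mathcal{X}^* ),\ \mathrm{dist}_{\|\cdot\|}(\bar x^t,\mathcal{X}^* )\}\le \frac{C_{\rm H}R_{y^*}\sqrt{\mathrm{dist}_{\rm KL}(x^0,\mathcal{X}^* )}}{\sqrt{p_{\min}\,\omega\big(p_{\min}^{-1/2}R_{y^*}\big)}\,\sqrt{t+1}}.$$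
   Context: Let $m,n\ge 1$, $[n]=\{1,\dots,n\}$, and $\Delta_n=\{x\in\mathbb{R}^n: x\ge 0,\ \sum_{i=1}^n x_i=1\}$. Let $p_1,\dots,p_m>0$ with $\sum_{j=1}^m p_j=1$, $p_{\min}=\min_{j} p_j$, and let $a_1,\dots,a_m\in\mathbb{R}^n$ be entrywise nonnegative and nonzero; $a_{ji}$ is the $i$-th entry of $a_j$. Let $A$ be the $m\times n$ matrix with rows $a_j^\top$ and columns $A_1,\dots,A_n$. Let $f(x)=\sum_{j=1}^m p_j\ln(a_j^\top x)$ (with $\ln 0=-\infty$), $f^*=\max_{x\in\Delta_n} f(x)$, and let $\mathcal{X}^*\neq\emptyset$ be the set of maximizers of $f$ over $\Delta_n$. MG method: given $x^0\in\Delta_n$ with all entries positive, for $t\ge 0$ set $x_i^{t+1}=x_i^t\,\nabla_i f(x^t)$ for all $i\in[n]$, where $\nabla_i f(x)=\sum_{j=1}^m p_j\frac{a_{ji}}{a_j^\top x}$. (All iterates lie in $\Delta_n$ and satisfy $a_j^\top x^t>0$ for all $j$, so the method is well defined.) For $x,y\ge 0$, $D_{\rm KL}(y,x)=\sum_{i=1}^n y_i\ln(y_i/x_i)$, with conventions $0\ln 0=0$, $0\ln(0/0)=0$, and $a\ln(a/0)=+\infty$ for $a>0$. Let $\bar f(y)=\sum_{j=1}^m p_j\ln y_j$ and $\mathcal{Y}=A(\Delta_n)=\{Ax:x\in\Delta_n\}$; $y^*$ denotes the unique maximizer of $\bar f$ over $\mathcal{Y}$ (it has all entries positive, $\bar f(y^*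 )=f^*$, and $\mathcal{X}^*=\{x\in\Delta_n:Ax=y^*\}$). Define $\|y\|_{y^*}=\sqrt{\sum_{j=1}^m p_j(y_j/y_j^* )^2}$ for $y\in\mathbb{R}^m$, and $R_{y^*}=\max_{y\in\mathcal{Y}}\|y-y^*\|_{y^*}=\max_{i\in[n]}\|A_i-y^*\|_{y^*}$. Define $\omega(t)=t-\ln(1+t)$ for $t>-1$. Let $\|\cdot\|$ be any given norm on $\mathbb{R}^n$ and $\mathrm{dist}_{\|\cdot\|}(x,\mathcal{X}^* )=\min_{x^*\in\mathcal{X}^*}\|x-x^*\|$. $C_{\rm H}$ is a (Hoffman) constant with $0<C_{\rm H}<+\infty$ such that $\mathrm{dist}_{\|\cdot\|}(x,\mathcal{X}^* )\le C_{\rm H}\|Ax-y^*\|_{y^*}$ for all $x\in\Delta_n$ (such a constant exists). *)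

theory Defs
  imports "HOL-Analysis.Analysis"
begin

definition std_simplex :: "(real ^ 'n) set" where
  "std_simplex = {x. (\<forall>i. 0 \<le> x $ i) \<and> (\<Sum>i\<in>UNIV. x $ i) = 1}"

text \<open>Logarithm with \<open>ln 0 = -\<infinity>\<close>; it is only applied to nonnegative arguments.\<close>

definition ext_ln :: "real \<Rightarrow> ereal" where
  "ext_ln u = (if 0 < u then ereal (ln u) else -\<infinity>)"

text \<open>Below, \<open>p\<close> is the weight vector and the rows \<open>A $ j\<close> of the matrix \<open>A\<close> are the data
  vectors \<open>a\<^sub>j\<close>. The \<open>ereal\<close> sums never mix \<open>\<infinity>\<close> and \<open>-\<infinity>\<close>.\<close>

definition log_obj :: "real ^ 'm \<Rightarrow> real ^ 'n ^ 'm \<Rightarrow> real ^ 'n \<Rightarrow> ereal" where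
  "log_obj p A x = (\<Sum>j\<in>UNIV. ereal (p $ j) * ext_ln ((A $ j) \<bullet> x))"

definition opt_set :: "real ^ 'm \<Rightarrow> real ^ 'n ^ 'm \<Rightarrow> (real ^ 'n) set" where
  "opt_set p A = {x. is_arg_max (log_obj p A) (\<lambda>z. z \<in> std_simplex) x}"

definition mg_grad :: "real ^ 'm \<Rightarrow> real ^ 'n ^ 'm \<Rightarrow> real ^ 'n \<Rightarrow> real ^ 'n" where
  "mg_grad p A x = (\<chi> i. \<Sum>j\<in>UNIV. p $ j * (A $ j $ i / ((A $ j) \<bullet> x)))"

primrec mg_iter :: "real ^ 'm \<Rightarrow> real ^ 'n ^ 'm \<Rightarrow> real ^ 'n \<Rightarrow> nat \<Rightarrow> real ^ 'n" where
  "mg_iter p A x0 0 = x0"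
| "mg_iter p A x0 (Suc t) =
     (\<chi> i. mg_iter p A x0 t $ i * mg_grad p A (mg_iter p A x0 t) $ i)"

definition mg_avg :: "real ^ 'm \<Rightarrow> real ^ 'n ^ 'm \<Rightarrow> real ^ 'n \<Rightarrow> nat \<Rightarrow> real ^ 'n" where
  "mg_avg p A x0 t = (1 / (real t + 1)) *\<^sub>R (\<Sum>k\<le>t. mg_iter p A x0 k)"

definition kl_div :: "real ^ 'n \<Rightarrow> real ^ 'n \<Rightarrow> ereal" where
  "kl_div y x = (\<Sum>i\<in>UNIV.
     if y $ i = 0 then 0
     else if x $ i = 0 then \<infinity>
     else ereal (y $ i * ln (y $ i / x $ i)))"

text \<open>The infimum is a minimum when \<open>X\<close> is compact and nonempty and \<open>x\<close> is entrywise positive;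
  for \<open>X\<close> contained in the simplex it is then a nonnegative real number.\<close>

definition kl_dist :: "real ^ 'n \<Rightarrow> (real ^ 'n) set \<Rightarrow> ereal" where
  "kl_dist x X = (INF z\<in>X. kl_div z x)"

definition image_obj :: "real ^ 'm \<Rightarrow> real ^ 'm \<Rightarrow> ereal" where
  "image_obj p y = (\<Sum>j\<in>UNIV. ereal (p $ j) * ext_ln (y $ j))"

definition image_set :: "real ^ 'n ^ 'm \<Rightarrow> (real ^ 'm) set" where
  "image_set A = (\<lambda>x. A *v x) ` std_simplex"

definition y_opt :: "real ^ 'm \<Rightarrow> real ^ 'n ^ 'm \<Rightarrow> real ^ 'm" where
  "y_opt p A = (THE y. is_arg_max (image_obj p) (\<lambda>z. z \<in> image_set A) y)"

definition local_norm :: "real ^ 'm \<Rightarrow> real ^ 'n ^ 'm \<Rightarrow> real ^ 'm \<Rightarrow> real" where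
  "local_norm p A y = sqrt (\<Sum>j\<in>UNIV. p $ j * (y $ j / y_opt p A $ j)\<^sup>2)"

text \<open>The supremum is a maximum because \<open>image_set A\<close> is compact and nonempty.\<close>

definition local_radius :: "real ^ 'm \<Rightarrow> real ^ 'n ^ 'm \<Rightarrow> real" where
  "local_radius p A = (SUP y\<in>image_set A. local_norm p A (y - y_opt p A))"

definition omega :: "real \<Rightarrow> real" where
  "omega t = t - ln (1 + t)"

text \<open>An arbitrary norm, which need not be the Euclidean norm of the type class instance.\<close>

definition is_norm :: "('v::real_vector \<Rightarrow> real) \<Rightarrow> bool" where
  "is_norm N \<longleftrightarrow>
     (\<forall>x. 0 \<le> N x) \<and> (\<forall>x. N x = 0 \<longleftrightarrow> x = 0) \<and>
     (\<forall>c x. N (c *\<^sub>R x) = \<bar>c\<bar> * N x) \<and> (\<forall>x y. N (x + y) \<le> N x + N y)"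

text \<open>The infimum is a minimum when \<open>X\<close> is compact and nonempty, as \<open>opt_set p A\<close> is.\<close>

definition norm_dist :: "('v::real_vector \<Rightarrow> real) \<Rightarrow> 'v \<Rightarrow> 'v set \<Rightarrow> real" where
  "norm_dist N x X = (INF z\<in>X. N (x - z))"

end

theory Submission
  imports Defs
begin

text \<open>
  Jensen's inequality for \<open>ln\<close> and the optimality conditions bound the objective gap of \<open>x\<^sup>k\<close> by
  the decrease of the divergence from any optimum to \<open>x\<^sup>k\<close>; the sum over \<open>k\<close> telescopes.
  Since the objective is concave and nondecreasing along the iterates, both the last and the
  averaged iterate have gap at most \<open>dist\<^sub>K\<^sub>L / (t + 1)\<close>. Conversely, with
  \<open>u\<^sub>j = y\<^sub>j / y\<^sup>*\<^sub>j - 1\<close> the first-order condition \<open>\<Sum>\<^sub>j p\<^sub>j u\<^sub>j \<le> 0\<close> bounds the gap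
  from below by \<open>\<Sum>\<^sub>j p\<^sub>j omega u\<^sub>j\<close>, which is quadratic in \<open>u\<close> on bounded sets
  because \<open>omega s / s\<^sup>2\<close> is decreasing for \<open>s > 0\<close> and \<open>\<bar>u\<^sub>j\<bar> \<le> R / sqrt p\<^sub>m\<^sub>i\<^sub>n\<close>.
  The Hoffman bound then turns the gap into a distance.
\<close>

section \<open>Logarithmic inequalities\<close>

lemma ln_ge_one_minus_inverse:
  fixes x :: real
  assumes "0 < x"
  shows "1 - 1 / x \<le> ln x"
  using ln_le_minus_one[of "1 / x"] assms by (simp add: ln_div)

text \<open>Uses the tangent line of \<open>ln\<close> at the weighted mean \<open>c\<close>.
  Positivity of \<open>z\<close> is demanded only on the support of \<open>w\<close>, because
  gradient entries of zero columns vanish.\<close>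

lemma sum_mult_ln_le_ln_sum:
  fixes w z :: "'i \<Rightarrow> real"
  assumes "finite I" and w: "\<And>i. i \<in> I \<Longrightarrow> 0 \<le> w i" and w1: "sum w I = 1"
    and z: "\<And>i. i \<in> I \<Longrightarrow> 0 < w i \<Longrightarrow> 0 < z i"
  shows "(\<Sum>i\<in>I. w i * ln (z i)) \<le> ln (\<Sum>i\<in>I. w i * z i)"
proof -
  define c where "c = (\<Sum>i\<in>I. w i * z i)"
  have wz: "0 \<le> w i * z i" if "i \<in> I" for i
    using w[OF that] z[OF that] by (cases "w i = 0") auto
  have "\<exists>i\<in>I. w i \<noteq> 0"
    using w1 by (metis sum.neutral zero_neq_one)
  then obtain i where i: "i \<in> I" "w i \<noteq> 0" by blast
  then have "0 < w i * z i"
    using w[of i] z[of i] by (metis less_eq_real_def mult_pos_pos)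
  also have "w i * z i \<le> c"
    unfolding c_def using i wz assms(1) by (intro member_le_sum) auto
  finally have c: "0 < c" .
  have "w i * ln (z i) \<le> w i * z i / c - w i + w i * ln c" if "i \<in> I" for i
  proof (cases "w i = 0")
    case False
    then have "0 < w i" "0 < z i" using w[OF that] z[OF that] by auto
    then have "ln (z i) - ln c \<le> z i / c - 1"
      using ln_le_minus_one[of "z i / c"] c by (simp add: ln_div)
    then have "w i * (ln (z i) - ln c) \<le> w i * (z i / c - 1)"
      using \<open>0 < w i\<close> by (intro mult_left_mono) auto
    then show ?thesis by (simp add: algebra_simps)
  qed simp
  then have "(\<Sum>i\<in>I. w i * ln (z i)) \<le> (\<Sum>i\<in>I. w i * z i / c - w i + w i * ln c)"
    by (rule sum_mono)
  also have "\<dots> = c / c - 1 + ln c"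
    by (simp add: sum.distrib sum_subtractf w1 c_def flip: sum_divide_distrib sum_distrib_right)
  finally show ?thesis using c by (simp add: c_def)
qed

section \<open>Sign and quadratic lower bound of \<open>omega\<close>\<close>

lemma omega_pos: "0 < t \<Longrightarrow> 0 < omega t"
  unfolding omega_def using ln_add_one_self_less_self[of t] by simp

lemma omega_nonneg: "-1 < t \<Longrightarrow> 0 \<le> omega t"
  unfolding omega_def using ln_le_minus_one[of "1 + t"] by simp

lemma omega_eq_0: "-1 < t \<Longrightarrow> omega t = 0 \<Longrightarrow> t = 0"
  unfolding omega_def using ln_eq_minus_one[of "1 + t"] by simp

lemma omega_abs_le:
  assumes "-1 < u"
  shows "omega \<bar>u\<bar> \<le> omega u"
proof (cases "0 \<le> u")
  case False
  define s where "s = - u"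
  have s: "0 < s" "s < 1" using False assms by (auto simp: s_def)
  \<comment> \<open>\<open>h v\<close> is \<open>omega (- v) - omega v\<close>.\<close>
  define h :: "real \<Rightarrow> real" where "h = (\<lambda>v. ln (1 + v) - ln (1 - v) - 2 * v)"
  have "h 0 \<le> h s"
  proof (rule DERIV_nonneg_imp_nondecreasing[where f = h])
    fix x assume x: "0 \<le> x" "x \<le> s"
    have "(h has_real_derivative 1 / (1 + x) + 1 / (1 - x) - 2) (at x)"
      unfolding h_def using x s by (auto intro!: derivative_eq_intros)
    moreover have "1 / (1 + x) + 1 / (1 - x) - 2 = 2 * x\<^sup>2 / ((1 + x) * (1 - x))"
      using x s by (simp add: divide_simps) (simp add: algebra_simps power2_eq_square)
    moreover have "0 \<le> 2 * x\<^sup>2 / ((1 + x) * (1 - x))"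
      using x s by (intro divide_nonneg_nonneg mult_nonneg_nonneg) auto
    ultimately show "\<exists>y. (h has_real_derivative y) (at x) \<and> 0 \<le> y" by metis
  qed (use s in auto)
  then show ?thesis using False by (simp add: h_def omega_def s_def)
qed simp

lemma omega_over_square_antimono:
  assumes "0 < s" "s \<le> S"
  shows "omega S / S\<^sup>2 \<le> omega s / s\<^sup>2"
proof (rule DERIV_nonpos_imp_nonincreasing[where f = "\<lambda>v. omega v / v\<^sup>2", OF assms(2)])
  fix x assume "s \<le> x" "x \<le> S"
  then have x: "0 < x" using assms by simp
  \<comment> \<open>\<open>x * k x\<close> is the numerator of the derivative of
    \<open>omega v / v\<^sup>2\<close> at \<open>x\<close>; \<open>k\<close> starts at 0 and its
    derivative is minus a square.\<close>
  define k :: "real \<Rightarrow> real" where "k = (\<lambda>v. 1 / (1 + v) - 1 - v + 2 * ln (1 + v))"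
  have "k x \<le> k 0"
  proof (rule DERIV_nonpos_imp_nonincreasing[where f = k])
    fix v assume v: "0 \<le> v" "v \<le> x"
    have "(k has_real_derivative - (1 / (1 + v)\<^sup>2) - 1 + 2 / (1 + v)) (at v)"
      unfolding k_def using v
      by (auto intro!: derivative_eq_intros simp: power2_eq_square)
    moreover have "- (1 / (1 + v)\<^sup>2) - 1 + 2 / (1 + v) = - (1 - 1 / (1 + v))\<^sup>2"
      by (simp add: power2_eq_square algebra_simps)
    ultimately show "\<exists>y. (k has_real_derivative y) (at v) \<and> y \<le> 0"
      by (metis neg_le_0_iff_le zero_le_power2)
  qed (use x in auto)
  then have kx: "k x \<le> 0" by (simp add: k_def)
  have "((\<lambda>v. omega v / v\<^sup>2) has_real_derivative
      ((1 - 1 / (1 + x)) * x\<^sup>2 - omega x * (2 * x)) / (x\<^sup>2 * x\<^sup>2)) (at x)"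
    unfolding omega_def using x by (auto intro!: derivative_eq_intros)
  moreover have "(1 - 1 / (1 + x)) * x\<^sup>2 - omega x * (2 * x) = x * k x"
    unfolding k_def omega_def using x
    by (simp add: divide_simps) (simp add: algebra_simps power2_eq_square)
  moreover have "x * k x / (x\<^sup>2 * x\<^sup>2) \<le> 0"
    using x kx by (simp add: divide_nonpos_pos mult_nonneg_nonpos)
  ultimately show "\<exists>y. ((\<lambda>v. omega v / v\<^sup>2) has_real_derivative y) (at x) \<and> y \<le> 0"
    by metis
qed

lemma omega_quadratic_lower_bound:
  assumes "-1 < u" "\<bar>u\<bar> \<le> S" "0 < S"
  shows "omega S / S\<^sup>2 * u\<^sup>2 \<le> omega u"
proof (cases "u = 0")
  case False
  then have "omega S / S\<^sup>2 \<le> omega \<bar>u\<bar> / u\<^sup>2"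
    using omega_over_square_antimono[of "\<bar>u\<bar>" S] assms by simp
  also have "\<dots> \<le> omega u / u\<^sup>2"
    using omega_abs_le[OF assms(1)] by (intro divide_right_mono) auto
  finally show ?thesis using False by (simp add: pos_le_divide_eq)
qed (simp add: omega_def)

section \<open>The maximizer over the image of the simplex\<close>

lemma std_simplexD:
  assumes "x \<in> std_simplex"
  shows "0 \<le> x $ i" "(\<Sum>i\<in>UNIV. x $ i) = 1"
  using assms by (auto simp: std_simplex_def)

lemma axis_in_std_simplex: "axis i 1 \<in> std_simplex"
  by (auto simp: std_simplex_def axis_def)

lemma convex_std_simplex: "convex std_simplex"
  unfolding std_simplex_def
  by (intro convexI) (auto simp: sum.distrib simp flip: sum_distrib_left)

lemma compact_std_simplex: "compact (std_simplex :: (real ^ 'n) set)"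
proof -
  have "std_simplex = (\<Inter>i. {x :: real ^ 'n. 0 \<le> x $ i}) \<inter> {x. (\<Sum>i\<in>UNIV. x $ i) = 1}"
    by (auto simp: std_simplex_def)
  moreover have "closed \<dots>"
    by (intro closed_Int closed_INT ballI closed_Collect_le closed_Collect_eq continuous_intros)
  moreover have "bounded (std_simplex :: (real ^ 'n) set)"
  proof (rule boundedI)
    fix x :: "real ^ 'n" assume x: "x \<in> std_simplex"
    have "norm x \<le> (\<Sum>i\<in>UNIV. norm (x $ i))" by (simp add: norm_le_l1_cart)
    also have "\<dots> = 1" using std_simplexD[OF x] by simp
    finally show "norm x \<le> 1" .
  qed
  ultimately show ?thesis by (simp add: compact_eq_bounded_closed)
qed

text \<open>The objective sees \<open>x\<close> only through \<open>A *v x\<close>, so maximization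
  moves to the image of the simplex, where the maximizer is unique.\<close>

lemma log_obj_eq_image_obj: "log_obj p A x = image_obj p (A *v x)"
  by (simp add: log_obj_def image_obj_def matrix_vector_mult_def inner_vec_def)

locale mg_instance =
  fixes p :: "real ^ 'm" and A :: "real ^ 'n ^ 'm" and x0 :: "real ^ 'n"
  assumes p_pos: "\<And>j. 0 < p $ j"
    and p_sum: "(\<Sum>j\<in>UNIV. p $ j) = 1"
    and A_nonneg: "\<And>j i. 0 \<le> A $ j $ i"
    and A_nonzero: "\<And>j. A $ j \<noteq> 0"
    and x0_simplex: "x0 \<in> std_simplex"
    and x0_pos: "\<And>i. 0 < x0 $ i"
begin

text \<open>Agrees with \<open>image_obj\<close> only on entrywise positive vectors, so positivity
  is tracked throughout.\<close>

definition obj :: "real ^ 'm \<Rightarrow> real" where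
  "obj y = (\<Sum>j\<in>UNIV. p $ j * ln (y $ j))"

abbreviation "ys \<equiv> y_opt p A"

lemma mult_vec_nth: "(A *v x) $ j = (\<Sum>i\<in>UNIV. A $ j $ i * x $ i)"
  by (simp add: matrix_vector_mult_def)

text \<open>Zero columns of \<open>A\<close> are allowed; the corresponding entries of an iterate vanish
  after one step.\<close>

lemma mult_vec_pos:
  assumes "\<And>i. 0 \<le> x $ i" "\<And>i j. 0 < A $ j $ i \<Longrightarrow> 0 < x $ i"
  shows "0 < (A *v x) $ j"
proof -
  obtain i where i: "A $ j $ i \<noteq> 0" using A_nonzero[of j] by (auto simp: vec_eq_iff)
  then have "0 < A $ j $ i" using A_nonneg[of j i] by simp
  then show ?thesis unfolding mult_vec_nth
    using assms A_nonneg by (intro sum_pos2[of _ i]) auto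
qed

lemma image_obj_eq:
  assumes "\<And>j. 0 < y $ j"
  shows "image_obj p y = ereal (obj y)"
  using assms by (simp add: image_obj_def obj_def ext_ln_def)

lemma image_obj_eq_MInf:
  assumes "\<not> 0 < y $ j"
  shows "image_obj p y = -\<infinity>"
proof -
  have eq: "ereal (p $ j) * ext_ln (y $ j) = -\<infinity>"
    using assms p_pos[of j] by (simp add: ext_ln_def)
  \<comment> \<open>In \<open>ereal\<close>, \<infinity> absorbs -\<infinity>, so the other summands
    must be shown to differ from \<infinity>.\<close>
  have "ereal (p $ k) * ext_ln (y $ k) \<noteq> \<infinity>" for k
    using p_pos[of k] by (simp add: ext_ln_def)
  then have "(\<Sum>k\<in>UNIV - {j}. ereal (p $ k) * ext_ln (y $ k)) \<noteq> \<infinity>"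
    by (simp add: sum_Pinfty)
  then show ?thesis
    unfolding image_obj_def by (subst sum.remove[of _ j]) (auto simp: eq)
qed

lemma image_set_nonneg: "y \<in> image_set A \<Longrightarrow> 0 \<le> y $ j"
  by (auto simp: image_set_def mult_vec_nth A_nonneg std_simplexD intro!: sum_nonneg)

lemma convex_image_set: "convex (image_set A)"
  unfolding image_set_def
  by (intro convex_linear_image convex_std_simplex matrix_vector_mul_linear)

lemma compact_image_set: "compact (image_set A)"
  unfolding image_set_def
  by (intro compact_continuous_image compact_std_simplex linear_continuous_on
      matrix_vector_mul_bounded_linear)

text \<open>Optimality in real terms: competitors with a vanishing entry have value -\<infinity> and
  can be left out.\<close>

definition is_opt :: "real ^ 'm \<Rightarrow> bool" where
  "is_opt y \<longleftrightarrow> y \<in> image_set A \<and> (\<forall>j. 0 < y $ j) \<and>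
     (\<forall>z\<in>image_set A. (\<forall>j. 0 < z $ j) \<longrightarrow> obj z \<le> obj y)"

lemma mult_x0: "A *v x0 \<in> image_set A" "0 < (A *v x0) $ j"
  using x0_simplex by (auto simp: image_set_def std_simplexD x0_pos intro!: mult_vec_pos)

lemma is_arg_max_iff: "is_arg_max (image_obj p) (\<lambda>z. z \<in> image_set A) y \<longleftrightarrow> is_opt y"
proof
  assume *: "is_arg_max (image_obj p) (\<lambda>z. z \<in> image_set A) y"
  then have le: "image_obj p z \<le> image_obj p y" if "z \<in> image_set A" for z
    using that by (auto simp: is_arg_max_def not_less)
  have pos: "0 < y $ j" for j
  proof (rule ccontr)
    assume "\<not> 0 < y $ j"
    then have "image_obj p y = -\<infinity>" by (rule image_obj_eq_MInf)
    moreover have "image_obj p (A *v x0) = ereal (obj (A *v x0))"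
      by (intro image_obj_eq mult_x0)
    ultimately show False using le[OF mult_x0(1)] by simp
  qed
  then show "is_opt y"
    using * le by (auto simp: is_opt_def is_arg_max_def) (metis ereal_less_eq(3) image_obj_eq)
next
  assume *: "is_opt y"
  have "image_obj p z \<le> image_obj p y" if "z \<in> image_set A" for z
  proof (cases "\<forall>j. 0 < z $ j")
    case True
    then show ?thesis using * that by (auto simp: is_opt_def image_obj_eq)
  next
    case False
    then obtain j where "\<not> 0 < z $ j" by auto
    then show ?thesis by (simp add: image_obj_eq_MInf)
  qed
  then show "is_arg_max (image_obj p) (\<lambda>z. z \<in> image_set A) y"
    using * by (auto simp: is_arg_max_def is_opt_def not_less)
qed

lemma is_opt_exists: "\<exists>y. is_opt y"
proof -
  define G where "G = (\<lambda>y :: real ^ 'm. \<Prod>j\<in>UNIV. (y $ j) powr (p $ j))"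
  have "continuous_on (image_set A) G"
    unfolding G_def using p_pos
    by (intro continuous_on_prod continuous_on_powr' continuous_intros)
       (auto simp: image_set_nonneg less_imp_le)
  then obtain y where y: "y \<in> image_set A" "\<And>z. z \<in> image_set A \<Longrightarrow> G z \<le> G y"
    using continuous_attains_sup[OF compact_image_set] mult_x0 by blast
  have G: "0 < G z \<and> ln (G z) = obj z" if "\<And>j. 0 < z $ j" for z
    using that by (auto simp: G_def obj_def ln_prod ln_powr prod_pos less_imp_neq[THEN not_sym])
  have "0 < G y" using y(2)[OF mult_x0(1)] G[OF mult_x0(2)] by linarith
  then have pos: "0 < y $ j" for j
    using image_set_nonneg[OF y(1), of j] by (auto simp: G_def less_le)
  have "obj z \<le> obj y" if "z \<in> image_set A" "\<forall>j. 0 < z $ j" for z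
    using G[of z] G[of y] y(2)[OF that(1)] that(2) pos by (metis ln_le_cancel_iff)
  then show ?thesis using y pos by (auto simp: is_opt_def)
qed

text \<open>The left-hand side minus 1 is the slope of \<open>obj\<close> at \<open>ys'\<close>
  towards \<open>y\<close>; a positive slope would give a better point on the segment. The maximizer
  is a variable because its uniqueness rests on this bound.\<close>

lemma first_order_optimality:
  assumes "is_opt ys'" "y \<in> image_set A"
  shows "(\<Sum>j\<in>UNIV. p $ j * (y $ j / ys' $ j)) \<le> 1"
proof (rule ccontr)
  assume "\<not> ?thesis"
  then have gt: "0 < (\<Sum>j\<in>UNIV. p $ j * (y $ j / ys' $ j)) - 1" by simp
  have pos: "0 < ys' $ j" for j using assms by (auto simp: is_opt_def)
  define g where "g = (\<lambda>s. obj (ys' + s *\<^sub>R (y - ys')))"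
  have "(g has_real_derivative (\<Sum>j\<in>UNIV. p $ j * ((y $ j - ys' $ j) / ys' $ j))) (at 0)"
    unfolding g_def obj_def using pos by (auto intro!: derivative_eq_intros sum.cong)
  also have "(\<Sum>j\<in>UNIV. p $ j * ((y $ j - ys' $ j) / ys' $ j))
      = (\<Sum>j\<in>UNIV. p $ j * (y $ j / ys' $ j)) - 1"
    using pos[THEN less_imp_neq] p_sum
    by (simp add: diff_divide_distrib right_diff_distrib sum_subtractf less_imp_neq[THEN not_sym])
  finally obtain d where d: "0 < d" "\<And>h. 0 < h \<Longrightarrow> h < d \<Longrightarrow> g 0 < g (0 + h)"
    using DERIV_pos_inc_right[OF _ gt] by blast
  define h where "h = min (d / 2) (1 / 2)"
  have h: "0 < h" "h < d" "h < 1" using d by (auto simp: h_def)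
  have eq: "ys' + h *\<^sub>R (y - ys') = (1 - h) *\<^sub>R ys' + h *\<^sub>R y"
    by (simp add: algebra_simps)
  have "ys' + h *\<^sub>R (y - ys') \<in> image_set A"
    unfolding eq using convex_image_set assms h by (intro convexD) (auto simp: is_opt_def)
  moreover have "0 < (ys' + h *\<^sub>R (y - ys')) $ j" for j
    unfolding eq using pos[of j] image_set_nonneg[OF assms(2), of j] h by (simp add: add_pos_nonneg)
  ultimately have "g h \<le> g 0" using assms(1) by (auto simp: g_def is_opt_def)
  with d(2)[of h] h show False by simp
qed

text \<open>For \<open>u = y $ j / ys' $ j - 1\<close>, \<open>- ln (1 + u) = omega u - u\<close>;
  the weighted sum of the linear terms is at most 0 by first-order optimality.\<close>

lemma obj_gap_ge_sum_omega:
  assumes "is_opt ys'" "y \<in> image_set A" "\<And>j. 0 < y $ j"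
  shows "(\<Sum>j\<in>UNIV. p $ j * omega (y $ j / ys' $ j - 1)) \<le> obj ys' - obj y"
proof -
  have pos: "0 < ys' $ j" for j using assms by (auto simp: is_opt_def)
  have "(\<Sum>j\<in>UNIV. p $ j * omega (y $ j / ys' $ j - 1))
      = (\<Sum>j\<in>UNIV. p $ j * (y $ j / ys' $ j) - p $ j + (p $ j * ln (ys' $ j) - p $ j * ln (y $ j)))"
    by (intro sum.cong refl, subst omega_def)
       (simp add: ln_div pos assms(3) less_imp_neq[THEN not_sym] right_diff_distrib)
  also have "\<dots> = (\<Sum>j\<in>UNIV. p $ j * (y $ j / ys' $ j)) - 1 + (obj ys' - obj y)"
    by (simp only: sum.distrib sum_subtractf obj_def p_sum)
  finally show ?thesis using first_order_optimality[OF assms(1,2)] by simp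
qed

text \<open>Two maximizers have gap 0, so every \<open>omega\<close> term vanishes, and 0 is the
  only zero of \<open>omega\<close>.\<close>

lemma is_opt_unique:
  assumes "is_opt y" "is_opt z"
  shows "y = z"
proof -
  have pos: "0 < y $ j" "0 < z $ j" for j using assms by (auto simp: is_opt_def)
  have "obj y = obj z" using assms by (intro antisym) (auto simp: is_opt_def)
  then have le: "(\<Sum>j\<in>UNIV. p $ j * omega (y $ j / z $ j - 1)) \<le> 0"
    using obj_gap_ge_sum_omega[OF assms(2), of y] assms(1) pos by (auto simp: is_opt_def)
  have nn: "0 \<le> p $ j * omega (y $ j / z $ j - 1)" for j
    using p_pos[of j] pos by (intro mult_nonneg_nonneg omega_nonneg) auto
  have "p $ j * omega (y $ j / z $ j - 1) = 0" for j
    using le nn sum_nonneg_eq_0_iff[of UNIV "\<lambda>j. p $ j * omega (y $ j / z $ j - 1)"]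
    by (simp add: antisym sum_nonneg)
  then have "omega (y $ j / z $ j - 1) = 0" for j
    using p_pos[of j] by (metis less_irrefl mult_eq_0_iff)
  then have "y $ j / z $ j - 1 = 0" for j
    using omega_eq_0[of "y $ j / z $ j - 1"] divide_pos_pos[OF pos, of j] by simp
  then have "y $ j = z $ j" for j
    using pos(2)[of j] by (simp add: field_simps)
  then show ?thesis by (simp add: vec_eq_iff)
qed

lemma is_opt_y_opt: "is_opt ys"
proof -
  obtain y where "is_opt y" using is_opt_exists by auto
  then show ?thesis unfolding y_opt_def is_arg_max_iff
    using is_opt_unique by (metis (no_types, lifting) theI)
qed

lemma y_opt_pos: "0 < ys $ j"
  using is_opt_y_opt by (auto simp: is_opt_def)

lemma opt_set_iff: "x \<in> opt_set p A \<longleftrightarrow> x \<in> std_simplex \<and> A *v x = ys"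
proof -
  have "x \<in> opt_set p A \<longleftrightarrow>
      x \<in> std_simplex \<and> is_arg_max (image_obj p) (\<lambda>z. z \<in> image_set A) (A *v x)"
    by (auto simp: opt_set_def is_arg_max_def log_obj_eq_image_obj image_set_def)
  then show ?thesis
    using is_arg_max_iff is_opt_unique is_opt_y_opt by metis
qed

lemma opt_set_nonempty: "opt_set p A \<noteq> {}"
  using is_opt_y_opt by (auto simp: is_opt_def image_set_def opt_set_iff)

section \<open>Quadratic growth\<close>

lemma local_norm_le_local_radius:
  assumes "y \<in> image_set A"
  shows "local_norm p A (y - ys) \<le> local_radius p A"
  unfolding local_radius_def
proof (rule cSUP_upper[OF assms])
  have "continuous_on (image_set A) (\<lambda>y. local_norm p A (y - ys))"
    unfolding local_norm_def using y_opt_pos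
    by (intro continuous_intros) (auto simp: less_imp_neq[THEN not_sym])
  then show "bdd_above ((\<lambda>y. local_norm p A (y - ys)) ` image_set A)"
    by (intro bounded_imp_bdd_above compact_imp_bounded compact_continuous_image
        compact_image_set)
qed

lemma local_norm_square:
  "(local_norm p A (y - ys))\<^sup>2 = (\<Sum>j\<in>UNIV. p $ j * (y $ j / ys $ j - 1)\<^sup>2)"
proof -
  have "(local_norm p A (y - ys))\<^sup>2 = (\<Sum>j\<in>UNIV. p $ j * ((y - ys) $ j / ys $ j)\<^sup>2)"
    unfolding local_norm_def
    by (intro real_sqrt_pow2 sum_nonneg mult_nonneg_nonneg) (auto simp: p_pos less_imp_le)
  also have "\<dots> = (\<Sum>j\<in>UNIV. p $ j * (y $ j / ys $ j - 1)\<^sup>2)"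
    by (simp add: diff_divide_distrib y_opt_pos less_imp_neq[THEN not_sym])
  finally show ?thesis .
qed

text \<open>\<open>S\<close> bounds all relative deviations \<open>u j\<close>, since each squared
  deviation enters the squared local norm with weight at least \<open>q\<close>. The positivity
  claim serves a later division.\<close>

lemma quadratic_growth:
  fixes q S :: real
  defines "q \<equiv> (MIN j. p $ j)"
  defines "S \<equiv> q powr (- 1 / 2) * local_radius p A"
  assumes R: "0 < local_radius p A" and y: "y \<in> image_set A" "\<And>j. 0 < y $ j"
  shows "0 < q * omega S"
    and "q * omega S * (local_norm p A (y - ys))\<^sup>2 \<le> (local_radius p A)\<^sup>2 * (obj ys - obj y)"
proof -
  let ?R = "local_radius p A"
  have q: "0 < q" unfolding q_def using p_pos by (subst Min_gr_iff) auto
  have qle: "q \<le> p $ j" for j unfolding q_def by (intro Min_le) auto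
  have S: "0 < S" using q R by (simp add: S_def)
  have "(q powr (- 1 / 2))\<^sup>2 = 1 / q"
    using q by (simp add: powr_minus_divide powr_half_sqrt power_divide)
  then have S2: "S\<^sup>2 = ?R\<^sup>2 / q" by (simp add: S_def power_mult_distrib)
  show "0 < q * omega S" using q omega_pos[OF S] by simp
  define u where "u = (\<lambda>j. y $ j / ys $ j - 1)"
  have u1: "-1 < u j" for j using y y_opt_pos by (simp add: u_def)
  have uS: "\<bar>u j\<bar> \<le> S" for j
  proof -
    have "q * (u j)\<^sup>2 \<le> p $ j * (u j)\<^sup>2" using qle by (intro mult_right_mono) auto
    also have "\<dots> \<le> (\<Sum>j\<in>UNIV. p $ j * (u j)\<^sup>2)"
      by (intro member_le_sum) (auto simp: p_pos less_imp_le)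
    also have "\<dots> = (local_norm p A (y - ys))\<^sup>2" by (simp add: local_norm_square u_def)
    also have "\<dots> \<le> ?R\<^sup>2"
      by (intro power_mono local_norm_le_local_radius y)
         (auto simp: local_norm_def p_pos less_imp_le intro!: sum_nonneg)
    finally have "(u j)\<^sup>2 \<le> S\<^sup>2" using q by (simp add: S2 field_simps)
    then show ?thesis using S by (simp add: abs_le_square_iff[symmetric])
  qed
  have "omega S / S\<^sup>2 * (local_norm p A (y - ys))\<^sup>2 = (\<Sum>j\<in>UNIV. p $ j * (omega S / S\<^sup>2 * (u j)\<^sup>2))"
    unfolding local_norm_square u_def sum_distrib_left by (simp add: mult_ac)
  also have "\<dots> \<le> (\<Sum>j\<in>UNIV. p $ j * omega (u j))"
    using p_pos by (intro sum_mono mult_left_mono omega_quadratic_lower_bound u1 uS S)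
      (auto simp: less_imp_le)
  also have "\<dots> \<le> obj ys - obj y"
    unfolding u_def by (intro obj_gap_ge_sum_omega is_opt_y_opt y)
  finally show "q * omega S * (local_norm p A (y - ys))\<^sup>2 \<le> ?R\<^sup>2 * (obj ys - obj y)"
    using q R by (simp add: S2 field_simps)
qed

section \<open>The multiplicative gradient iteration\<close>

abbreviation "X \<equiv> mg_iter p A x0"

text \<open>Gradient of the objective, indexed by the image point so that it can also be taken at
  \<open>ys\<close>.\<close>

definition grad :: "real ^ 'm \<Rightarrow> 'n \<Rightarrow> real" where
  "grad y i = (\<Sum>j\<in>UNIV. p $ j * (A $ j $ i / y $ j))"

lemma mg_iter_Suc: "X (Suc k) $ i = X k $ i * grad (A *v X k) i"
  by (simp add: mg_grad_def grad_def mult_vec_nth inner_vec_def)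

lemma grad_nonneg: "(\<And>j. 0 < y $ j) \<Longrightarrow> 0 \<le> grad y i"
  unfolding grad_def using A_nonneg p_pos
  by (intro sum_nonneg mult_nonneg_nonneg divide_nonneg_nonneg) (auto simp: less_imp_le)

lemma grad_pos:
  assumes "\<And>j. 0 < y $ j" "0 < A $ j $ i"
  shows "0 < grad y i"
  unfolding grad_def using A_nonneg p_pos assms
  by (intro sum_pos2[of _ j]) (auto simp: less_imp_le intro!: mult_nonneg_nonneg divide_nonneg_nonneg)

text \<open>For positive \<open>y = A *v x\<close> the value is 1: the iteration preserves total
  mass, and gradient entries at an optimum average to 1.\<close>

lemma sum_mult_grad:
  "(\<Sum>i\<in>UNIV. x $ i * grad y i) = (\<Sum>j\<in>UNIV. p $ j * ((A *v x) $ j / y $ j))"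
proof -
  have "(\<Sum>i\<in>UNIV. x $ i * grad y i) = (\<Sum>i\<in>UNIV. \<Sum>j\<in>UNIV. x $ i * (p $ j * (A $ j $ i / y $ j)))"
    by (simp add: grad_def sum_distrib_left)
  also have "\<dots> = (\<Sum>j\<in>UNIV. \<Sum>i\<in>UNIV. x $ i * (p $ j * (A $ j $ i / y $ j)))"
    by (rule sum.swap)
  also have "\<dots> = (\<Sum>j\<in>UNIV. p $ j * ((A *v x) $ j / y $ j))"
    by (simp add: mult_vec_nth sum_distrib_left sum_divide_distrib mult_ac)
  finally show ?thesis .
qed

text \<open>The parts need each other: a positive image makes the gradient positive on nonzero
  columns, which keeps those coordinates and then the next image positive.\<close>

lemma iter_invariant:
  "X k \<in> std_simplex \<and> (\<forall>i j. 0 < A $ j $ i \<longrightarrow> 0 < X k $ i) \<and> (\<forall>j. 0 < (A *v X k) $ j)"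
proof (induction k)
  case 0
  then show ?case using x0_simplex x0_pos mult_x0 by simp
next
  case (Suc k)
  then have pos: "0 < (A *v X k) $ j" for j by auto
  have "(\<Sum>i\<in>UNIV. X (Suc k) $ i) = (\<Sum>j\<in>UNIV. p $ j * ((A *v X k) $ j / (A *v X k) $ j))"
    unfolding mg_iter_Suc by (rule sum_mult_grad)
  also have "\<dots> = 1" using pos by (simp add: p_sum less_imp_neq[THEN not_sym])
  finally have sum: "(\<Sum>i\<in>UNIV. X (Suc k) $ i) = 1" .
  have nn: "0 \<le> X (Suc k) $ i" for i
    unfolding mg_iter_Suc using Suc pos by (intro mult_nonneg_nonneg grad_nonneg) (auto simp: std_simplexD)
  have "0 < X (Suc k) $ i" if "0 < A $ j $ i" for i j
    unfolding mg_iter_Suc using Suc pos that by (intro mult_pos_pos grad_pos) auto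
  then show ?case using nn sum mult_vec_pos[of "X (Suc k)"] by (auto simp: std_simplex_def)
qed

lemma iter_simplex: "X k \<in> std_simplex"
  and iter_pos: "0 < A $ j $ i \<Longrightarrow> 0 < X k $ i"
  and mult_iter_pos: "0 < (A *v X k) $ j"
  using iter_invariant by auto

text \<open>The sum of \<open>?x $ i * (?g i * ln (?g i))\<close> is the divergence of the new
  iterate from the old one. It is nonnegative, and Jensen's inequality bounds it by the increase of
  the objective.\<close>

lemma obj_iter_mono: "obj (A *v X k) \<le> obj (A *v X (Suc k))"
proof -
  let ?x = "X k" and ?y = "A *v X k"
  let ?g = "grad ?y"
  have x: "0 \<le> ?x $ i" for i using iter_simplex by (rule std_simplexD)
  have y: "0 < ?y $ j" for j by (rule mult_iter_pos)
  have "0 = (\<Sum>i\<in>UNIV. ?x $ i * ?g i) - (\<Sum>i\<in>UNIV. ?x $ i)"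
    using std_simplexD(2)[OF iter_simplex, of "Suc k"] std_simplexD(2)[OF iter_simplex, of k]
    unfolding mg_iter_Suc by simp
  also have "\<dots> = (\<Sum>i\<in>UNIV. ?x $ i * (?g i - 1))"
    by (simp add: sum_subtractf right_diff_distrib)
  also have "\<dots> \<le> (\<Sum>i\<in>UNIV. ?x $ i * (?g i * ln (?g i)))"
  proof (intro sum_mono mult_left_mono x)
    fix i
    show "?g i - 1 \<le> ?g i * ln (?g i)"
    proof (cases "?g i = 0")
      case False
      then have g: "0 < ?g i" using grad_nonneg[of ?y i] y by simp
      then have "?g i * (1 - 1 / ?g i) \<le> ?g i * ln (?g i)"
        by (intro mult_left_mono ln_ge_one_minus_inverse) auto
      then show ?thesis using g by (simp add: right_diff_distrib)
    qed simp
  qed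
  also have "\<dots> = (\<Sum>i\<in>UNIV. \<Sum>j\<in>UNIV. p $ j * (A $ j $ i * ?x $ i / ?y $ j * ln (?g i)))"
    by (subst (1) grad_def) (simp add: sum_distrib_left sum_distrib_right mult_ac)
  also have "\<dots> = (\<Sum>j\<in>UNIV. p $ j * (\<Sum>i\<in>UNIV. A $ j $ i * ?x $ i / ?y $ j * ln (?g i)))"
    by (subst sum.swap) (simp add: sum_distrib_left)
  \<comment> \<open>For each \<open>j\<close>, the Jensen weights are the shares of the coordinates
    of \<open>?x\<close> in \<open>?y $ j\<close>.\<close>
  also have "\<dots> \<le> (\<Sum>j\<in>UNIV. p $ j * ln (\<Sum>i\<in>UNIV. A $ j $ i * ?x $ i / ?y $ j * ?g i))"
  proof (intro sum_mono mult_left_mono sum_mult_ln_le_ln_sum)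
    fix j
    show "(\<Sum>i\<in>UNIV. A $ j $ i * ?x $ i / ?y $ j) = 1"
      using y[of j] by (simp add: mult_vec_nth flip: sum_divide_distrib)
    show "0 \<le> p $ j" using p_pos by (simp add: less_imp_le)
    fix i
    show "0 \<le> A $ j $ i * ?x $ i / ?y $ j" using A_nonneg x y by (simp add: less_imp_le)
    assume "0 < A $ j $ i * ?x $ i / ?y $ j"
    then have "0 < A $ j $ i" using A_nonneg[of j i] by (auto simp: less_le)
    then show "0 < ?g i" using y by (intro grad_pos)
  qed simp
  also have "\<dots> = (\<Sum>j\<in>UNIV. p $ j * ln ((A *v X (Suc k)) $ j / ?y $ j))"
    unfolding mult_vec_nth[of "X (Suc k)"] mg_iter_Suc by (simp add: sum_divide_distrib mult_ac)
  also have "\<dots> = obj (A *v X (Suc k)) - obj ?y"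
    by (simp add: obj_def ln_div mult_iter_pos less_imp_neq[THEN not_sym] right_diff_distrib
        sum_subtractf del: mg_iter.simps)
  finally show ?thesis by simp
qed

section \<open>Kullback-Leibler divergence from an optimum\<close>

text \<open>Being real, it does not return \<infinity> where \<open>x $ i = 0 < z $ i\<close>;
  inclusion of supports has to be secured separately.\<close>

definition kl :: "real ^ 'n \<Rightarrow> real ^ 'n \<Rightarrow> real" where
  "kl z x = (\<Sum>i\<in>UNIV. z $ i * ln (z $ i / x $ i))"

text \<open>Gibbs' inequality: each term is at least \<open>z $ i - x $ i\<close>, and these
  differences sum to 0.\<close>

lemma kl_nonneg:
  assumes "z \<in> std_simplex" "x \<in> std_simplex" and pos: "\<And>i. 0 < z $ i \<Longrightarrow> 0 < x $ i"
  shows "0 \<le> kl z x"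
proof -
  have "0 = (\<Sum>i\<in>UNIV. z $ i - x $ i)" using assms by (simp add: sum_subtractf std_simplexD)
  also have "\<dots> \<le> kl z x"
    unfolding kl_def
  proof (rule sum_mono)
    fix i
    show "z $ i - x $ i \<le> z $ i * ln (z $ i / x $ i)"
    proof (cases "z $ i = 0")
      case False
      then have *: "0 < z $ i" "0 < x $ i" using std_simplexD(1)[OF assms(1), of i] pos by (auto simp: less_le)
      then have "z $ i * (1 - 1 / (z $ i / x $ i)) \<le> z $ i * ln (z $ i / x $ i)"
        by (intro mult_left_mono ln_ge_one_minus_inverse) auto
      then show ?thesis using * by (simp add: right_diff_distrib)
    qed (use std_simplexD(1)[OF assms(2)] in simp)
  qed
  finally show ?thesis .
qed

text \<open>Complementary slackness: first-order optimality at the vertices of the simplex gives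
  entries at most 1, while their \<open>z\<close>-average is 1.\<close>

lemma grad_y_opt_eq_1:
  assumes "z \<in> opt_set p A" "z $ i \<noteq> 0"
  shows "grad ys i = 1"
proof -
  have z: "z \<in> std_simplex" "A *v z = ys" using assms by (auto simp: opt_set_iff)
  have "(A *v axis i 1) $ j = A $ j $ i" for i j
    by (simp add: mult_vec_nth axis_def if_distrib cong: if_cong)
  then have le: "grad ys i \<le> 1" for i
    using first_order_optimality[OF is_opt_y_opt, of "A *v axis i 1"]
    by (auto simp: grad_def image_set_def axis_in_std_simplex)
  have "(\<Sum>i\<in>UNIV. z $ i * grad ys i) = 1"
    by (simp add: sum_mult_grad z p_sum y_opt_pos less_imp_neq[THEN not_sym])
  then have "(\<Sum>i\<in>UNIV. z $ i * (1 - grad ys i)) = 0"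
    using std_simplexD(2)[OF z(1)] by (simp add: right_diff_distrib sum_subtractf)
  then have "z $ i * (1 - grad ys i) = 0"
    using le z by (subst (asm) sum_nonneg_eq_0_iff) (auto simp: std_simplexD)
  then show ?thesis using assms(2) by simp
qed

text \<open>A zero column would have gradient entry 0 instead of 1, so an optimum charges only
  coordinates that the iterates keep positive.\<close>

lemma opt_support:
  assumes "z \<in> opt_set p A" "z $ i \<noteq> 0"
  shows "0 < X k $ i"
proof -
  have "\<exists>j. A $ j $ i \<noteq> 0"
  proof (rule ccontr)
    assume "\<nexists>j. A $ j $ i \<noteq> 0"
    then have "grad ys i = 0" by (simp add: grad_def)
    with grad_y_opt_eq_1[OF assms] show False by simp
  qed
  then obtain j where "0 < A $ j $ i" using A_nonneg by (metis less_le)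
  then show ?thesis by (rule iter_pos)
qed

text \<open>For \<open>i\<close> in the support of the optimum \<open>z\<close>, the numbers \<open>p\<^sub>j a\<^sub>j\<^sub>i / y\<^sup>*\<^sub>j\<close> form a
  probability vector by optimality, so Jensen's inequality applies to \<open>ln (grad y i)\<close>.\<close>

lemma obj_gap_le_kl_decrease:
  assumes z: "z \<in> opt_set p A"
  shows "obj ys - obj (A *v X k) \<le> kl z (X k) - kl z (X (Suc k))"
proof -
  let ?y = "A *v X k"
  let ?w = "\<lambda>i j. p $ j * (A $ j $ i / ys $ j)"
  have zs: "z \<in> std_simplex" "A *v z = ys" using z by (auto simp: opt_set_iff)
  have y: "0 < ?y $ j" for j by (rule mult_iter_pos)
  have "obj ys - obj ?y = (\<Sum>j\<in>UNIV. p $ j * ln (ys $ j / ?y $ j))"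
    by (simp add: obj_def ln_div y y_opt_pos less_imp_neq[THEN not_sym] right_diff_distrib
        sum_subtractf)
  \<comment> \<open>The inserted factor is 1; expanding \<open>(A *v z) $ j\<close> splits the gap
    over the coordinates of \<open>z\<close>.\<close>
  also have "\<dots> = (\<Sum>j\<in>UNIV. p $ j * ((A *v z) $ j / ys $ j) * ln (ys $ j / ?y $ j))"
    by (simp add: zs y_opt_pos less_imp_neq[THEN not_sym])
  also have "\<dots> = (\<Sum>j\<in>UNIV. \<Sum>i\<in>UNIV. z $ i * (?w i j * ln (ys $ j / ?y $ j)))"
    by (simp add: mult_vec_nth sum_distrib_left sum_distrib_right sum_divide_distrib mult_ac)
  also have "\<dots> = (\<Sum>i\<in>UNIV. z $ i * (\<Sum>j\<in>UNIV. ?w i j * ln (ys $ j / ?y $ j)))"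
    by (subst sum.swap) (simp add: sum_distrib_left)
  also have "\<dots> \<le> (\<Sum>i\<in>UNIV. z $ i * ln (z $ i / X k $ i) - z $ i * ln (z $ i / X (Suc k) $ i))"
  proof (rule sum_mono)
    fix i
    show "z $ i * (\<Sum>j\<in>UNIV. ?w i j * ln (ys $ j / ?y $ j))
      \<le> z $ i * ln (z $ i / X k $ i) - z $ i * ln (z $ i / X (Suc k) $ i)"
    proof (cases "z $ i = 0")
      case False
      then have zi: "0 < z $ i" using std_simplexD(1)[OF zs(1), of i] by simp
      have xi: "0 < X k $ i" "0 < X (Suc k) $ i" using opt_support[OF z False] by blast+
      have "(\<Sum>j\<in>UNIV. ?w i j * ln (ys $ j / ?y $ j)) \<le> ln (\<Sum>j\<in>UNIV. ?w i j * (ys $ j / ?y $ j))"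
        using grad_y_opt_eq_1[OF z False] y y_opt_pos A_nonneg p_pos
        by (intro sum_mult_ln_le_ln_sum) (auto simp: grad_def less_imp_le)
      also have "(\<Sum>j\<in>UNIV. ?w i j * (ys $ j / ?y $ j)) = grad ?y i"
        using y_opt_pos by (simp add: grad_def less_imp_neq[THEN not_sym])
      \<comment> \<open>The gradient entry is the multiplicative update, so its logarithm is a
        difference of divergence terms.\<close>
      also have "grad ?y i = X (Suc k) $ i / X k $ i"
        using xi by (simp add: mg_iter_Suc del: mg_iter.simps)
      also have "ln \<dots> = ln (z $ i / X k $ i) - ln (z $ i / X (Suc k) $ i)"
        using xi zi by (simp add: ln_div del: mg_iter.simps)
      finally have "z $ i * (\<Sum>j\<in>UNIV. ?w i j * ln (ys $ j / ?y $ j))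
          \<le> z $ i * (ln (z $ i / X k $ i) - ln (z $ i / X (Suc k) $ i))"
        using zi by (intro mult_left_mono) auto
      then show ?thesis by (simp only: right_diff_distrib)
    qed simp
  qed
  finally show ?thesis by (simp only: kl_def sum_subtractf)
qed

lemma sum_obj_gap_le_kl:
  assumes z: "z \<in> opt_set p A"
  shows "(\<Sum>k\<le>t. obj ys - obj (A *v X k)) \<le> kl z x0"
proof -
  have "(\<Sum>k\<le>t. obj ys - obj (A *v X k)) \<le> (\<Sum>k\<le>t. kl z (X k) - kl z (X (Suc k)))"
    by (intro sum_mono obj_gap_le_kl_decrease z)
  also have "\<dots> = kl z (X 0) - kl z (X (Suc t))" by (rule sum_telescope)
  also have "0 \<le> kl z (X (Suc t))"
    using z iter_simplex[of "Suc t"] opt_support[OF z, of _ "Suc t"]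
    by (intro kl_nonneg) (auto simp: opt_set_iff)
  then have "kl z (X 0) - kl z (X (Suc t)) \<le> kl z x0" by simp
  finally show ?thesis .
qed

lemma kl_div_eq_kl: "kl_div z x0 = ereal (kl z x0)"
proof -
  have "kl_div z x0 = (\<Sum>i\<in>UNIV. ereal (z $ i * ln (z $ i / x0 $ i)))"
    unfolding kl_div_def by (intro sum.cong refl) (auto simp: x0_pos less_imp_neq[THEN not_sym])
  then show ?thesis by (simp add: kl_def)
qed

text \<open>\<open>real_of_ereal\<close> sends infinite values to 0, so finiteness is established
  too: one optimum bounds the infimum above, \<open>c\<close> bounds it below.\<close>

lemma le_kl_dist:
  assumes "\<And>z. z \<in> opt_set p A \<Longrightarrow> c \<le> kl z x0"
  shows "c \<le> real_of_ereal (kl_dist x0 (opt_set p A))"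
proof -
  let ?d = "kl_dist x0 (opt_set p A)"
  obtain z where z: "z \<in> opt_set p A" using opt_set_nonempty by auto
  have "?d \<le> ereal (kl z x0)"
    unfolding kl_dist_def kl_div_eq_kl by (rule INF_lower[OF z])
  moreover have "ereal c \<le> ?d"
    unfolding kl_dist_def kl_div_eq_kl using assms by (intro INF_greatest) auto
  ultimately show ?thesis by (cases ?d) auto
qed

section \<open>Gap bounds for the last and the averaged iterate\<close>

lemma mg_avg_nth: "mg_avg p A x0 t $ i = (\<Sum>k\<le>t. 1 / (real t + 1) * X k $ i)"
  by (simp add: mg_avg_def sum_divide_distrib)

lemma mult_mg_avg_nth: "(A *v mg_avg p A x0 t) $ j = (\<Sum>k\<le>t. 1 / (real t + 1) * (A *v X k) $ j)"
  unfolding mult_vec_nth mg_avg_nth sum_distrib_left by (subst sum.swap) (simp add: mult_ac)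

lemma mg_avg_simplex: "mg_avg p A x0 t \<in> std_simplex"
proof -
  have "(\<Sum>i\<in>UNIV. \<Sum>k\<le>t. 1 / (real t + 1) * X k $ i) = (\<Sum>k\<le>t. 1 / (real t + 1) * (\<Sum>i\<in>UNIV. X k $ i))"
    by (subst sum.swap) (simp only: sum_distrib_left)
  also have "\<dots> = 1" by (simp add: std_simplexD(2)[OF iter_simplex])
  finally have "(\<Sum>i\<in>UNIV. mg_avg p A x0 t $ i) = 1" unfolding mg_avg_nth .
  moreover have "0 \<le> mg_avg p A x0 t $ i" for i
    unfolding mg_avg_nth by (intro sum_nonneg mult_nonneg_nonneg std_simplexD(1) iter_simplex) auto
  ultimately show ?thesis by (simp add: std_simplex_def)
qed

lemma mult_mg_avg_pos: "0 < (A *v mg_avg p A x0 t) $ j"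
  unfolding mult_mg_avg_nth by (intro sum_pos mult_pos_pos mult_iter_pos) auto

text \<open>By monotonicity the last of the \<open>t + 1\<close> summed gaps is the
  smallest.\<close>

lemma iter_gap:
  assumes z: "z \<in> opt_set p A"
  shows "(real t + 1) * (obj ys - obj (A *v X t)) \<le> kl z x0"
proof -
  have mono: "obj (A *v X k) \<le> obj (A *v X t)" if "k \<le> t" for k
    using obj_iter_mono that by (rule lift_Suc_mono_le)
  have "(real t + 1) * (obj ys - obj (A *v X t)) = (\<Sum>k\<le>t. obj ys - obj (A *v X t))"
    by simp
  also have "\<dots> \<le> (\<Sum>k\<le>t. obj ys - obj (A *v X k))"
    using mono by (intro sum_mono) auto
  finally show ?thesis using sum_obj_gap_le_kl[OF z, of t] by simp
qed

text \<open>Jensen's inequality in each image coordinate, with \<open>t + 1\<close> equal weights,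
  bounds the gap of the average by the average gap.\<close>

lemma avg_gap:
  assumes z: "z \<in> opt_set p A"
  shows "(real t + 1) * (obj ys - obj (A *v mg_avg p A x0 t)) \<le> kl z x0"
proof -
  let ?c = "1 / (real t + 1)"
  have "(\<Sum>k\<le>t. ?c * obj (A *v X k)) = (\<Sum>j\<in>UNIV. p $ j * (\<Sum>k\<le>t. ?c * ln ((A *v X k) $ j)))"
    unfolding obj_def sum_distrib_left by (subst sum.swap) (simp add: mult_ac)
  also have "\<dots> \<le> obj (A *v mg_avg p A x0 t)"
    unfolding obj_def mult_mg_avg_nth using p_pos
    by (intro sum_mono mult_left_mono sum_mult_ln_le_ln_sum mult_iter_pos) (auto simp: less_imp_le)
  finally have "(\<Sum>k\<le>t. obj (A *v X k)) / (real t + 1) \<le> obj (A *v mg_avg p A x0 t)"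
    by (simp add: sum_divide_distrib)
  then have "(\<Sum>k\<le>t. obj (A *v X k)) \<le> (real t + 1) * obj (A *v mg_avg p A x0 t)"
    by (simp add: field_simps)
  moreover have "(\<Sum>k\<le>t. obj ys - obj (A *v X k)) = (real t + 1) * obj ys - (\<Sum>k\<le>t. obj (A *v X k))"
    by (simp add: sum_subtractf)
  ultimately show ?thesis using sum_obj_gap_le_kl[OF z, of t] by (simp add: right_diff_distrib)
qed

text \<open>Stated for any point satisfying the gap bound, so that it serves both the last and the
  averaged iterate.\<close>

lemma local_norm_bound:
  fixes q S :: real
  defines "q \<equiv> (MIN j. p $ j)"
  defines "S \<equiv> q powr (- 1 / 2) * local_radius p A"
  assumes R: "0 < local_radius p A" and x: "x \<in> std_simplex" "\<And>j. 0 < (A *v x) $ j"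
    and gap: "\<And>z. z \<in> opt_set p A \<Longrightarrow> (real t + 1) * (obj ys - obj (A *v x)) \<le> kl z x0"
  shows "local_norm p A (A *v x - ys) \<le>
    local_radius p A * sqrt (real_of_ereal (kl_dist x0 (opt_set p A)))
      / (sqrt (q * omega S) * sqrt (real t + 1))"
proof -
  let ?R = "local_radius p A" and ?n = "local_norm p A (A *v x - ys)"
  let ?D = "real_of_ereal (kl_dist x0 (opt_set p A))"
  have Ax: "A *v x \<in> image_set A" using x by (simp add: image_set_def)
  note growth = quadratic_growth[OF R Ax x(2), folded q_def, folded S_def]
  have "(q * omega S * (real t + 1)) * ?n\<^sup>2 = (real t + 1) * (q * omega S * ?n\<^sup>2)"
    by (simp add: mult_ac)
  also have "\<dots> \<le> (real t + 1) * (?R\<^sup>2 * (obj ys - obj (A *v x)))"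
    by (intro mult_left_mono growth(2)) auto
  also have "\<dots> = ?R\<^sup>2 * ((real t + 1) * (obj ys - obj (A *v x)))" by (simp add: mult_ac)
  also have "\<dots> \<le> ?R\<^sup>2 * ?D" by (intro mult_left_mono le_kl_dist gap) auto
  finally have "sqrt ((q * omega S * (real t + 1)) * ?n\<^sup>2) \<le> sqrt (?R\<^sup>2 * ?D)"
    by (rule real_sqrt_le_mono)
  \<comment> \<open>The square root of \<open>?n\<^sup>2\<close> is the absolute value of
    \<open>?n\<close>.\<close>
  moreover have "0 \<le> ?n"
    by (auto simp: local_norm_def p_pos less_imp_le intro!: sum_nonneg)
  ultimately have "sqrt (q * omega S) * sqrt (real t + 1) * ?n \<le> ?R * sqrt ?D"
    using R by (simp add: real_sqrt_mult)
  then show ?thesis using growth(1) by (simp add: pos_le_divide_eq mult_ac)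
qed

end

section \<open>Distance to the optimal set in an arbitrary norm\<close>

theorem theorem2:
  fixes p :: "real ^ 'm" and A :: "real ^ 'n ^ 'm" and x0 :: "real ^ 'n"
    and N :: "real ^ 'n \<Rightarrow> real" and C_H :: real and t :: nat
  assumes p_pos: "\<And>j. 0 < p $ j"
    and p_sum: "(\<Sum>j\<in>UNIV. p $ j) = 1"
    and A_nonneg: "\<And>j i. 0 \<le> A $ j $ i"
    and A_nonzero: "\<And>j. A $ j \<noteq> 0"
    and x0_simplex: "x0 \<in> std_simplex"
    and x0_pos: "\<And>i. 0 < x0 $ i"
    and N_norm: "is_norm N"
    and C_H_pos: "0 < C_H"
    and hoffman: "\<And>x. x \<in> std_simplex \<Longrightarrow>
      norm_dist N x (opt_set p A) \<le> C_H * local_norm p A (A *v x - y_opt p A)"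
    and R_pos: "0 < local_radius p A"
  shows "max (norm_dist N (mg_iter p A x0 t) (opt_set p A))
             (norm_dist N (mg_avg p A x0 t) (opt_set p A))
    \<le> C_H * local_radius p A * sqrt (real_of_ereal (kl_dist x0 (opt_set p A)))
      / (sqrt ((MIN j. p $ j) * omega ((MIN j. p $ j) powr (- 1 / 2) * local_radius p A))
         * sqrt (real t + 1))" (is "_ \<le> ?B")
proof -
  interpret mg_instance p A x0
    by unfold_locales (fact p_pos p_sum A_nonneg A_nonzero x0_simplex x0_pos)+
  have bound: "norm_dist N x (opt_set p A) \<le> ?B"
    if x: "x \<in> std_simplex" "\<And>j. 0 < (A *v x) $ j"
      and gap: "\<And>z. z \<in> opt_set p A \<Longrightarrow> (real t + 1) * (obj ys - obj (A *v x)) \<le> kl z x0" for x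
  proof -
    have "norm_dist N x (opt_set p A) \<le> C_H * local_norm p A (A *v x - ys)"
      by (rule hoffman[OF x(1)])
    also have "\<dots> \<le> C_H * (local_radius p A * sqrt (real_of_ereal (kl_dist x0 (opt_set p A)))
      / (sqrt ((MIN j. p $ j) * omega ((MIN j. p $ j) powr (- 1 / 2) * local_radius p A))
         * sqrt (real t + 1)))"
      using C_H_pos by (intro mult_left_mono local_norm_bound R_pos x gap) auto
    finally show ?thesis by (simp add: mult.assoc)
  qed
  show ?thesis
    by (intro max.boundedI bound iter_simplex mult_iter_pos iter_gap
        mg_avg_simplex mult_mg_avg_pos avg_gap)
qed

end
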